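(* Let $W$ be a Coxeter group of type $A_n$, $B_n$, $D_n$, or $I_2(n)$ (one fixed family, $n$ varying), and let $w$ be sampled uniformly at random from $W$. Then, as $n\to\infty$, $$\Pr[w\text{ is } J(w)\text{-spherical}]\longrightarrow 0 .$$
   Context: Let $(W,S)$ be a finite Coxeter system with $S=\{s_1,\dots,s_N\}$ (so $N=n$ for types $A_n,B_n,D_n$, and $N=2$ for the dihedral group $I_2(n)$ of order $2n$), with Coxeter length $\ell$ and Coxeter diagram $\mathcal G$ on vertex set $[N]=\{1,\dots,N\}$. The left descent set of $w\in W$ is $J(w)=\{j\in[N]\mid \ell(s_jw)<\ell(w)\}$. For $I\subseteq[N]$ let $\mathcal G_I$ be the induced subdiagram of $\mathcal G$ on $I$, with connected components $\mathcal C^{(1)},\dots,\mathcal C^{(m)}$, and let $W^{(z)}$ be the parabolic subgroup of $W$ generated by the $s_i$ with $i$ a vertex of $\mathcal C^{(z)}$; $w_0(W^{(z)})$ denotes its longest element. For $w\in W$ and $I\subseteq J(w)$, $w$ is called $I$-spherical if there is a reduced word $s_{i_1}\cdots s_{i_{\ell(w)}}$ of $w$ such that: (S.1) $\#\{t: i_t=j\}\le 1$ for all $j\in[N]\setminus I$; and (S.2) $\#\{t: i_t\in\mathcal C^{(z)}\}\le \ell(w_0(W^{(z)}))+\#\mathrm{vertices}(\mathcal C^{(z)})$ for all $1\le z\le m$. *)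

theory Defs
  imports
    "HOL-Algebra.Generated_Groups"
    "HOL-Probability.Probability_Mass_Function"
begin

section \<open>Coxeter systems\<close>

text \<open>
  A Coxeter matrix on the index set \<open>{1..N}\<close>; the entry \<open>0\<close> encodes \<open>\<infinity>\<close> (no relation).
\<close>

definition is_coxeter_matrix :: "nat \<Rightarrow> (nat \<Rightarrow> nat \<Rightarrow> nat) \<Rightarrow> bool" where
  "is_coxeter_matrix N m \<longleftrightarrow>
     (\<forall>i\<in>{1..N}. m i i = 1) \<and>
     (\<forall>i\<in>{1..N}. \<forall>j\<in>{1..N}. m i j = m j i \<and> (i \<noteq> j \<longrightarrow> m i j \<noteq> 1))"

text \<open>
  The congruence on words over \<open>{1..N}\<close> generated by the relations \<open>(s\<^sub>i s\<^sub>j)^(m i j) = 1\<close>.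
  Since \<open>m i i = 1\<close>, these include \<open>s\<^sub>i s\<^sub>i = 1\<close>, so that every letter is its own inverse and
  the monoid presented in this way is the group with the same presentation.
\<close>

inductive coxeter_equiv :: "nat \<Rightarrow> (nat \<Rightarrow> nat \<Rightarrow> nat) \<Rightarrow> nat list \<Rightarrow> nat list \<Rightarrow> bool"
  for N :: nat and m :: "nat \<Rightarrow> nat \<Rightarrow> nat" where
  refl: "set u \<subseteq> {1..N} \<Longrightarrow> coxeter_equiv N m u u"
| sym: "coxeter_equiv N m u v \<Longrightarrow> coxeter_equiv N m v u"
| trans: "coxeter_equiv N m u v \<Longrightarrow> coxeter_equiv N m v w \<Longrightarrow> coxeter_equiv N m u w"
| rel: "set u \<subseteq> {1..N} \<Longrightarrow> set v \<subseteq> {1..N} \<Longrightarrow> i \<in> {1..N} \<Longrightarrow> j \<in> {1..N} \<Longrightarrow>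
        coxeter_equiv N m (u @ concat (replicate (m i j) [i, j]) @ v) (u @ v)"

definition word_prod :: "('a, 'b) monoid_scheme \<Rightarrow> (nat \<Rightarrow> 'a) \<Rightarrow> nat list \<Rightarrow> 'a" where
  "word_prod W s u = foldr (\<lambda>i x. s i \<otimes>\<^bsub>W\<^esub> x) u \<one>\<^bsub>W\<^esub>"

text \<open>
  \<open>W\<close> is the group with generators \<open>s 1, ..., s N\<close> presented by the Coxeter matrix \<open>m\<close>.
\<close>

locale coxeter_system = group W
  for W :: "('a, 'b) monoid_scheme" (structure) +
  fixes N :: nat and s :: "nat \<Rightarrow> 'a" and m :: "nat \<Rightarrow> nat \<Rightarrow> nat"
  assumes coxeter_matrix: "is_coxeter_matrix N m"
    and generators_closed: "s ` {1..N} \<subseteq> carrier W"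
    and generated: "generate W (s ` {1..N}) = carrier W"
    and presentation:
      "set u \<subseteq> {1..N} \<Longrightarrow> set v \<subseteq> {1..N} \<Longrightarrow>
        word_prod W s u = word_prod W s v \<longleftrightarrow> coxeter_equiv N m u v"
begin

definition cox_length :: "'a \<Rightarrow> nat" where
  "cox_length w = (LEAST k. \<exists>u. set u \<subseteq> {1..N} \<and> word_prod W s u = w \<and> length u = k)"

definition reduced_word :: "'a \<Rightarrow> nat list \<Rightarrow> bool" where
  "reduced_word w u \<longleftrightarrow>
     set u \<subseteq> {1..N} \<and> word_prod W s u = w \<and> length u = cox_length w"

definition left_descents :: "'a \<Rightarrow> nat set" where
  "left_descents w = {j \<in> {1..N}. cox_length (s j \<otimes> w) < cox_length w}"

text \<open>
  Edges of the Coxeter diagram: \<open>m i j \<ge> 3\<close> or \<open>m i j = \<infinity>\<close> (encoded as \<open>0\<close>), that is,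
  \<open>m i j \<noteq> 2\<close> for distinct \<open>i, j\<close>.
\<close>

definition diagram_edges :: "(nat \<times> nat) set" where
  "diagram_edges = {(i, j) \<in> {1..N} \<times> {1..N}. i \<noteq> j \<and> m i j \<noteq> 2}"

text \<open>Vertex sets of the connected components of the induced subdiagram on \<open>I\<close>.\<close>

definition diagram_components :: "nat set \<Rightarrow> nat set set" where
  "diagram_components I = I // {(i, j) \<in> I \<times> I. (i, j) \<in> (diagram_edges \<inter> I \<times> I)\<^sup>*}"

definition parabolic :: "nat set \<Rightarrow> 'a set" where
  "parabolic I = generate W (s ` I)"

definition longest_element :: "nat set \<Rightarrow> 'a" where
  "longest_element I = (ARG_MAX cox_length w. w \<in> parabolic I)"

definition spherical :: "'a \<Rightarrow> nat set \<Rightarrow> bool" where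
  "spherical w I \<longleftrightarrow> I \<subseteq> left_descents w \<and>
     (\<exists>u. reduced_word w u \<and>
        (\<forall>j \<in> {1..N} - I. card {t. t < length u \<and> u ! t = j} \<le> 1) \<and>
        (\<forall>C \<in> diagram_components I.
           card {t. t < length u \<and> u ! t \<in> C} \<le> cox_length (longest_element C) + card C))"

end

locale finite_coxeter_system = coxeter_system +
  assumes finite_carrier: "finite (carrier W)"


section \<open>The families $A_n$, $B_n$, $D_n$ and $I_2(n)$\<close>

datatype coxeter_family = TypeA | TypeB | TypeD | TypeI2

fun family_start :: "coxeter_family \<Rightarrow> nat" where
  "family_start TypeA = 1"
| "family_start TypeB = 2"
| "family_start TypeD = 4"
| "family_start TypeI2 = 3"

fun family_rank :: "coxeter_family \<Rightarrow> nat \<Rightarrow> nat" where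
  "family_rank TypeI2 n = 2"
| "family_rank _ n = n"

text \<open>
  The vertices are numbered as in Bourbaki: the edge with label \<open>4\<close> in type \<open>B\<^sub>n\<close> joins \<open>n - 1\<close>
  and \<open>n\<close>, and in type \<open>D\<^sub>n\<close> the vertices \<open>n - 1\<close> and \<open>n\<close> are both joined to \<open>n - 2\<close>.
\<close>

fun family_matrix :: "coxeter_family \<Rightarrow> nat \<Rightarrow> nat \<Rightarrow> nat \<Rightarrow> nat" where
  "family_matrix TypeA n i j =
     (if i = j then 1 else if max i j = min i j + 1 then 3 else 2)"
| "family_matrix TypeB n i j =
     (if i = j then 1
      else if max i j = min i j + 1 then (if max i j = n then 4 else 3) else 2)"
| "family_matrix TypeD n i j =
     (if i = j then 1
      else if (max i j = min i j + 1 \<and> max i j < n) \<or> (max i j = n \<and> min i j + 2 = n)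
           then 3 else 2)"
| "family_matrix TypeI2 n i j = (if i = j then 1 else n)"

end

theory Submission
  imports Defs "HOL-Combinatorics.Transposition" "HOL-Real_Asymp.Real_Asymp"
begin

text \<open>
  By (S.1), a letter \<open>j\<close> that is not a left descent of a spherical \<open>w\<close> occurs at most once in some
  word for \<open>w\<close>. In types \<open>A\<close>, \<open>B\<close> and \<open>D\<close> forgetting signs gives a transitive action on points in
  which \<open>s\<^sub>j\<close> is an adjacent transposition and the other generators preserve \<open>{1..j}\<close>, so for \<open>j \<ge> 2\<close>
  such a \<open>w\<close> maps some point of \<open>{1..j}\<close> into \<open>{1..j}\<close>; this has probability \<open>O(j\<^sup>2 / n)\<close>. On the
  other hand \<open>s\<^sub>2, s\<^sub>4, \<dots>, s\<^sub>2\<^sub>k\<close> commute, and left multiplication by one of them toggles that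
  descent and keeps the others, so all of them are left descents with probability at most \<open>2\<^sup>-\<^sup>k\<close>.
  In type \<open>I\<^sub>2\<close>, (S.1) leaves only words of length at most 3, apart from the longest element.
\<close>

section \<open>Two summation rules for the parity count\<close>

lemma sum_lessThan_shift2:
  fixes g :: "nat \<Rightarrow> nat"
  shows "sum g {..<2 * Suc k} = g 0 + g 1 + (\<Sum>p<2 * k. g (Suc (Suc p)))"
  by (induction k) (simp_all add: numeral_2_eq_2)

lemma sum_lessThan_add_periodic:
  fixes g :: "nat \<Rightarrow> nat"
  assumes "\<And>p. g (n + p) = g p"
  shows "sum g {..<n + k} = sum g {..<n} + sum g {..<k}"
  by (induction k) (simp_all add: assms)

section \<open>Words, lengths and reduced words in a Coxeter system\<close>

context coxeter_system
begin

abbreviation wp :: "nat list \<Rightarrow> 'a" where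
  "wp u \<equiv> word_prod W s u"

lemma wp_Nil [simp]: "wp [] = \<one>"
  by (simp add: word_prod_def)

lemma wp_Cons [simp]: "wp (i # u) = s i \<otimes> wp u"
  by (simp add: word_prod_def)

lemma s_closed [simp]: "i \<in> {1..N} \<Longrightarrow> s i \<in> carrier W"
  using generators_closed by blast

lemma wp_closed [simp]: "set u \<subseteq> {1..N} \<Longrightarrow> wp u \<in> carrier W"
  by (induction u) auto

lemma wp_append: "set u \<subseteq> {1..N} \<Longrightarrow> set v \<subseteq> {1..N} \<Longrightarrow> wp (u @ v) = wp u \<otimes> wp v"
  by (induction u) (auto simp: m_assoc)

lemma set_relator: "i \<in> A \<Longrightarrow> j \<in> A \<Longrightarrow> set (concat (replicate k [i, j])) \<subseteq> A"
  by (induction k) auto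

lemma wp_relator:
  assumes "i \<in> {1..N}" "j \<in> {1..N}"
  shows "wp (concat (replicate (m i j) [i, j])) = \<one>"
proof -
  have "coxeter_equiv N m ([] @ concat (replicate (m i j) [i, j]) @ []) ([] @ [])"
    using assms by (intro coxeter_equiv.rel) auto
  then show ?thesis
    using presentation[OF set_relator[OF assms] , of "[]"] by simp
qed

lemma s_involution: "i \<in> {1..N} \<Longrightarrow> s i \<otimes> s i = \<one>"
  using wp_relator[of i i] coxeter_matrix by (auto simp: is_coxeter_matrix_def)

lemma s_cancel: "i \<in> {1..N} \<Longrightarrow> x \<in> carrier W \<Longrightarrow> s i \<otimes> (s i \<otimes> x) = x"
  by (metis s_closed s_involution l_one m_assoc)

lemma inv_s: "i \<in> {1..N} \<Longrightarrow> inv (s i) = s i"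
  by (simp add: inv_equality s_involution)

lemma word_exists:
  assumes "w \<in> carrier W"
  obtains u where "set u \<subseteq> {1..N}" "wp u = w"
proof -
  have "w \<in> generate W (s ` {1..N})"
    using assms generated by simp
  then have "\<exists>u. set u \<subseteq> {1..N} \<and> wp u = w"
  proof induction
    case one
    show ?case by (intro exI[of _ "[]"]) simp
  next
    case (incl h)
    then obtain i where "i \<in> {1..N}" "h = s i" by auto
    then show ?case by (intro exI[of _ "[i]"]) auto
  next
    case (inv h)
    then obtain i where "i \<in> {1..N}" "h = s i" by auto
    then show ?case by (intro exI[of _ "[i]"]) (auto simp: inv_s)
  next
    case (eng h1 h2)
    then obtain u1 u2 where "set u1 \<subseteq> {1..N}" "wp u1 = h1" "set u2 \<subseteq> {1..N}" "wp u2 = h2"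
      by blast
    then show ?case by (intro exI[of _ "u1 @ u2"]) (auto simp: wp_append)
  qed
  then show thesis using that by blast
qed

lemma cox_length_le: "set u \<subseteq> {1..N} \<Longrightarrow> cox_length (wp u) \<le> length u"
  unfolding cox_length_def by (rule Least_le) blast

lemma reduced_word_exists:
  assumes "w \<in> carrier W"
  obtains u where "reduced_word w u"
proof -
  have "\<exists>k u. set u \<subseteq> {1..N} \<and> wp u = w \<and> length u = k"
    using word_exists[OF assms] by metis
  from LeastI_ex[OF this] show thesis
    using that unfolding reduced_word_def cox_length_def by blast
qed

section \<open>Reflection parities and left descents\<close>

text \<open>
  For a word \<open>i\<^sub>1 \<dots> i\<^sub>q\<close>, this is the parity of the number of \<open>p\<close> such that \<open>t\<close> is the reflection
  \<open>(s i\<^sub>1 \<dots> s i\<^sub>p\<^sub>-\<^sub>1) (s i\<^sub>p) (s i\<^sub>1 \<dots> s i\<^sub>p\<^sub>-\<^sub>1)\<^sup>-\<^sup>1\<close>.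
\<close>

primrec refl_parity :: "nat list \<Rightarrow> 'a \<Rightarrow> bool" where
  "refl_parity [] t = False"
| "refl_parity (i # u) t = ((t = s i) \<noteq> refl_parity u (s i \<otimes> t \<otimes> s i))"

text \<open>The prefix \<open>u\<close> conjugates every reflection contributed by \<open>v\<close>
  by \<open>wp u\<close>; undoing this conjugation on \<open>t\<close> tests \<open>v\<close> alone.
  On booleans, \<open>\<noteq>\<close> is addition modulo 2.\<close>

lemma refl_parity_append:
  assumes "set u \<subseteq> {1..N}" "set v \<subseteq> {1..N}" "t \<in> carrier W"
  shows "refl_parity (u @ v) t =
    (refl_parity u t \<noteq> refl_parity v (inv (wp u) \<otimes> t \<otimes> wp u))"
  using assms
  by (induction u arbitrary: t) (auto simp: inv_mult_group inv_s m_assoc)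

text \<open>With \<open>c = s i \<otimes> s j\<close>, conjugation by \<open>s i\<close> inverts
  \<open>c\<close>, so \<open>c \<otimes> (c [^] p \<otimes> s i) \<otimes> inv c = c [^] (p + 2)
  \<otimes> s i\<close>. Stripping two letters off an alternating word thus shifts the exponent by
  2.\<close>

lemma conj_eq_pow_iff:
  assumes "i \<in> {1..N}" "j \<in> {1..N}" "t \<in> carrier W"
  shows "s j \<otimes> (s i \<otimes> t \<otimes> s i) \<otimes> s j = (s i \<otimes> s j) [^] (p::nat) \<otimes> s i \<longleftrightarrow>
         t = (s i \<otimes> s j) [^] (Suc (Suc p)) \<otimes> s i"
proof -
  define c where "c = s i \<otimes> s j"
  have c: "c \<in> carrier W" using assms c_def by simp
  have si: "s i \<in> carrier W" and sj: "s j \<in> carrier W" using assms by auto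
  have cp: "c [^] p \<in> carrier W" using c by simp
  have ic: "inv c = s j \<otimes> s i"
    using assms by (simp add: c_def inv_mult_group inv_s)
  have "s j \<otimes> (s i \<otimes> t \<otimes> s i) \<otimes> s j = inv c \<otimes> (t \<otimes> c)"
    unfolding ic using assms si sj by (simp add: c_def m_assoc)
  also have "\<dots> = c [^] p \<otimes> s i \<longleftrightarrow> t \<otimes> c = c \<otimes> (c [^] p \<otimes> s i)"
    by (metis (no_types, lifting) assms(3) c cp inv_solve_left m_closed si)
  also have "\<dots> \<longleftrightarrow> t = c \<otimes> (c [^] p \<otimes> s i) \<otimes> inv c"
    by (metis (no_types, lifting) assms(3) c cp inv_solve_right m_closed si)
  also have "c \<otimes> (c [^] p \<otimes> s i) \<otimes> inv c = c \<otimes> c [^] p \<otimes> (s i \<otimes> s j) \<otimes> s i"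
    unfolding ic using c cp si sj by (simp add: m_assoc)
  also have "c \<otimes> c [^] p \<otimes> (s i \<otimes> s j) = c [^] (Suc (Suc p))"
    using nat_pow_Suc2[OF c, of p] by (simp flip: c_def)
  finally show ?thesis by (simp add: c_def)
qed

text \<open>The reflection at position \<open>p\<close>, counted from 0, of the word
  \<open>i, j, i, j, ...\<close> is \<open>(s i \<otimes> s j) [^] p \<otimes> s i\<close>. The
  induction peels off one pair of letters at a time.\<close>

lemma refl_parity_relator_sum:
  assumes "i \<in> {1..N}" "j \<in> {1..N}" "t \<in> carrier W"
  shows "refl_parity (concat (replicate k [i, j])) t \<longleftrightarrow>
    odd (\<Sum>p<2 * k. of_bool (t = (s i \<otimes> s j) [^] p \<otimes> s i) :: nat)"
  using assms(3)
proof (induction k arbitrary: t)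
  case 0
  then show ?case by simp
next
  case (Suc k)
  let ?t = "s j \<otimes> (s i \<otimes> t \<otimes> s i) \<otimes> s j"
  have si: "s i \<in> carrier W" and sj: "s j \<in> carrier W" using assms by auto
  have t: "?t \<in> carrier W" using Suc.prems si sj by simp
  have 1: "s i \<otimes> t \<otimes> s i = s j \<longleftrightarrow> t = s i \<otimes> s j \<otimes> s i"
  proof
    assume "s i \<otimes> t \<otimes> s i = s j"
    moreover have "t = s i \<otimes> (s i \<otimes> t \<otimes> s i) \<otimes> s i"
      using assms(1) Suc.prems si by (simp add: m_assoc s_cancel s_involution)
    ultimately show "t = s i \<otimes> s j \<otimes> s i" by metis
  next
    assume "t = s i \<otimes> s j \<otimes> s i"
    then show "s i \<otimes> t \<otimes> s i = s j"
      using assms si sj by (simp add: m_assoc s_cancel s_involution)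
  qed
  have "(\<Sum>p<2 * Suc k. of_bool (t = (s i \<otimes> s j) [^] p \<otimes> s i) :: nat) =
     of_bool (t = s i) + of_bool (t = s i \<otimes> s j \<otimes> s i) +
     (\<Sum>p<2 * k. of_bool (t = (s i \<otimes> s j) [^] Suc (Suc p) \<otimes> s i))"
    using si sj by (subst sum_lessThan_shift2) simp
  also have "(\<Sum>p<2 * k. of_bool (t = (s i \<otimes> s j) [^] Suc (Suc p) \<otimes> s i) :: nat) =
     (\<Sum>p<2 * k. of_bool (?t = (s i \<otimes> s j) [^] p \<otimes> s i))"
    by (simp only: conj_eq_pow_iff[OF assms(1,2) Suc.prems])
  finally have "odd (\<Sum>p<2 * Suc k. of_bool (t = (s i \<otimes> s j) [^] p \<otimes> s i) :: nat) \<longleftrightarrow>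
     (t = s i) \<noteq> ((t = s i \<otimes> s j \<otimes> s i) \<noteq>
       odd (\<Sum>p<2 * k. of_bool (?t = (s i \<otimes> s j) [^] p \<otimes> s i) :: nat))"
    by auto
  then show ?case
    using 1 by (simp only: Suc.IH[OF t, symmetric]) simp
qed

text \<open>The exponents run through two full periods of length \<open>m i j\<close>, because the
  corresponding power of \<open>s i \<otimes> s j\<close> is trivial; hence each reflection is met
  an even number of times.\<close>

lemma refl_parity_relator:
  assumes "i \<in> {1..N}" "j \<in> {1..N}" "t \<in> carrier W"
  shows "\<not> refl_parity (concat (replicate (m i j) [i, j])) t"
proof -
  let ?c = "s i \<otimes> s j"
  let ?g = "\<lambda>p. of_bool (t = ?c [^] p \<otimes> s i) :: nat"
  have c: "?c \<in> carrier W" using assms by simp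
  have "wp (concat (replicate k [i, j])) = ?c [^] k" for k :: nat
  proof (induction k)
    case (Suc k)
    then show ?case
      using assms nat_pow_Suc2[OF c, of k] by (simp add: m_assoc)
  qed simp
  then have "?c [^] m i j = \<one>" using wp_relator assms by metis
  then have "?g (m i j + p) = ?g p" for p
    using c by (simp add: nat_pow_mult[symmetric])
  then have "(\<Sum>p<m i j + m i j. ?g p) = (\<Sum>p<m i j. ?g p) + (\<Sum>p<m i j. ?g p)"
    by (rule sum_lessThan_add_periodic)
  then have "even (\<Sum>p<2 * m i j. ?g p)"
    by (metis even_add mult_2)
  then show ?thesis
    using refl_parity_relator_sum[OF assms] by blast
qed

text \<open>An inserted relator has even parity everywhere and, being trivial in the group, does not
  conjugate what follows. By the presentation, the parity is therefore a function of the group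
  element.\<close>

lemma refl_parity_cong_equiv:
  "coxeter_equiv N m u v \<Longrightarrow> t \<in> carrier W \<Longrightarrow> refl_parity u t = refl_parity v t"
proof (induction arbitrary: t rule: coxeter_equiv.induct)
  case (rel u v i j)
  let ?r = "concat (replicate (m i j) [i, j])"
  have r: "set ?r \<subseteq> {1..N}" by (rule set_relator[OF rel(3,4)])
  have "wp ?r = \<one>" by (rule wp_relator) (use rel in auto)
  then have drop_r: "refl_parity (?r @ v) t' = refl_parity v t'" if "t' \<in> carrier W" for t'
    unfolding refl_parity_append[OF r rel(2) that]
    using refl_parity_relator[OF rel(3,4) that] that by simp
  have "inv (wp u) \<otimes> t \<otimes> wp u \<in> carrier W"
    using rel by simp
  note drop_r = drop_r[OF this]
  have rv: "set (?r @ v) \<subseteq> {1..N}" using r rel by simp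
  show ?case
    unfolding refl_parity_append[OF rel(1) rv rel(5)] refl_parity_append[OF rel(1,2,5)] drop_r ..
next
  case (trans u v w)
  show ?case using trans.IH(1)[OF trans.prems] trans.IH(2)[OF trans.prems] by (rule HOL.trans)
next
  case (sym u v)
  show ?case using sym.IH[OF sym.prems] by (rule HOL.sym)
qed simp

lemma refl_parity_cong:
  assumes "set u \<subseteq> {1..N}" "set v \<subseteq> {1..N}" "wp u = wp v" "t \<in> carrier W"
  shows "refl_parity u t = refl_parity v t"
  using presentation[OF assms(1,2)] refl_parity_cong_equiv[OF _ assms(4)] assms(3) by simp

text \<open>This is the exchange condition: odd parity makes \<open>t\<close> the reflection at some
  position, and left multiplication by \<open>t\<close> deletes the letter there.\<close>

lemma refl_parity_deletion:
  assumes "refl_parity u t" "t \<in> carrier W" "set u \<subseteq> {1..N}"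
  shows "\<exists>v. set v \<subseteq> {1..N} \<and> length v < length u \<and> wp v = t \<otimes> wp u"
  using assms
proof (induction u arbitrary: t)
  case Nil
  then show ?case by simp
next
  case (Cons i u)
  have i: "i \<in> {1..N}" and u: "set u \<subseteq> {1..N}" using Cons.prems by auto
  show ?case
  proof (cases "t = s i")
    case True
    then show ?thesis using i u by (intro exI[of _ u]) (auto simp: s_cancel)
  next
    case False
    then have "refl_parity u (s i \<otimes> t \<otimes> s i)" using Cons.prems by simp
    from Cons.IH[OF this] obtain v where v: "set v \<subseteq> {1..N}" "length v < length u"
      "wp v = s i \<otimes> t \<otimes> s i \<otimes> wp u" using Cons.prems i u by auto
    have "s i \<otimes> wp v = t \<otimes> (s i \<otimes> wp u)"
      using i u Cons.prems(2) unfolding v(3) by (simp add: m_assoc s_cancel)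
    then show ?thesis using v i by (intro exI[of _ "i # v"]) auto
  qed
qed

text \<open>Odd parity at \<open>s j\<close> allows a letter to be deleted, and even parity becomes
  odd after prepending \<open>j\<close>. Since any word may be used, descents can be followed under
  left multiplication without computing lengths.\<close>

lemma left_descent_iff:
  assumes "j \<in> {1..N}" "set u \<subseteq> {1..N}"
  shows "j \<in> left_descents (wp u) \<longleftrightarrow> refl_parity u (s j)"
proof -
  have shorter: "cox_length (s j \<otimes> wp v) < cox_length (wp v)"
    if v: "set v \<subseteq> {1..N}" and par: "refl_parity v (s j)" for v
  proof -
    \<comment> \<open>Deletion only shortens the word it is applied to, so a reduced one is taken;
      its parity is the same.\<close>
    obtain v' where v': "reduced_word (wp v) v'"
      using reduced_word_exists wp_closed[OF v] by blast
    then have "refl_parity v' (s j)"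
      using refl_parity_cong[of v v' "s j"] v par assms(1) by (auto simp: reduced_word_def)
    then obtain x where "set x \<subseteq> {1..N}" "length x < length v'" "wp x = s j \<otimes> wp v'"
      using refl_parity_deletion[of v' "s j"] v' assms(1) by (auto simp: reduced_word_def)
    then show ?thesis
      using cox_length_le[of x] v' by (auto simp: reduced_word_def)
  qed
  show ?thesis
  proof
    assume *: "j \<in> left_descents (wp u)"
    show "refl_parity u (s j)"
    proof (rule ccontr)
      assume "\<not> refl_parity u (s j)"
      \<comment> \<open>Prepending \<open>j\<close> flips the parity at \<open>s j\<close>, so
        \<open>shorter\<close> now makes \<open>wp u\<close> shorter than
        \<open>s j \<otimes> wp u\<close>.\<close>
      then have "refl_parity (j # u) (s j)"
        using assms(1) by (simp add: s_involution)
      from shorter[OF _ this] have "cox_length (wp u) < cox_length (s j \<otimes> wp u)"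
        using assms by (simp add: s_cancel)
      then show False using * by (simp add: left_descents_def)
    qed
  next
    assume "refl_parity u (s j)"
    then show "j \<in> left_descents (wp u)"
      using shorter assms by (simp add: left_descents_def)
  qed
qed

text \<open>Prepending \<open>i\<close> to a word leaves the parity at \<open>s j\<close> unchanged:
  conjugation by \<open>s i\<close> fixes \<open>s j\<close>, and the new letter contributes only
  the reflection \<open>s i\<close>.\<close>

lemma left_descent_mult_commuting:
  assumes ij: "i \<in> {1..N}" "j \<in> {1..N}" "s i \<noteq> s j" "s i \<otimes> s j = s j \<otimes> s i"
    and w: "w \<in> carrier W" "j \<in> left_descents w"
  shows "j \<in> left_descents (s i \<otimes> w)"
proof -
  obtain u where u: "set u \<subseteq> {1..N}" "wp u = w" using word_exists w by blast
  have "s i \<otimes> s j \<otimes> s i = s j"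
    using ij by (simp add: m_assoc s_involution)
  then have "refl_parity (i # u) (s j) = refl_parity u (s j)"
    using ij by auto
  then show ?thesis
    using left_descent_iff[of j u] left_descent_iff[of j "i # u"] u w ij by auto
qed

lemma not_left_descent_mult:
  assumes "w \<in> carrier W" "j \<in> left_descents w"
  shows "j \<notin> left_descents (s j \<otimes> w)"
  using assms by (auto simp: left_descents_def s_cancel)

lemma commute_of_m_eq_2:
  assumes "i \<in> {1..N}" "j \<in> {1..N}" "m i j = 2"
  shows "s i \<otimes> s j = s j \<otimes> s i"
proof -
  have "s i \<otimes> (s j \<otimes> (s i \<otimes> s j)) = \<one>"
    using wp_relator[OF assms(1,2)] assms by (simp add: numeral_2_eq_2)
  then have "s i \<otimes> s j = inv (s i \<otimes> s j)"
    using assms by (intro inv_equality[symmetric]) (auto simp: m_assoc)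
  then show ?thesis using assms by (simp add: inv_mult_group inv_s)
qed

lemma spherical_word:
  assumes "spherical w I"
  obtains u where "reduced_word w u"
    "\<And>j. j \<in> {1..N} - I \<Longrightarrow> count_list u j \<le> 1"
proof -
  have "card {t. t < length u \<and> u ! t = j} = count_list u j" for u and j :: nat
    by (simp add: count_list_eq_length_filter length_filter_conv_card eq_commute[of j])
  then show thesis using assms that unfolding spherical_def by metis
qed

end

section \<open>Counting elements with prescribed commuting descents\<close>

context finite_coxeter_system
begin

text \<open>Each new letter \<open>k\<close> halves the count: the elements having \<open>k\<close>
  as a further descent and their translates by \<open>s k\<close> are disjoint sets of equal size,
  and both keep all descents in \<open>K\<close>.\<close>

lemma card_all_left_descents:
  assumes "finite K" "K \<subseteq> {1..N}" "inj_on s K"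
    and "\<And>i j. i \<in> K \<Longrightarrow> j \<in> K \<Longrightarrow> s i \<otimes> s j = s j \<otimes> s i"
  shows "card {w \<in> carrier W. K \<subseteq> left_descents w} * 2 ^ card K \<le> card (carrier W)"
  using assms
proof (induction K)
  case empty
  then show ?case by simp
next
  case (insert k K)
  let ?A = "\<lambda>K. {w \<in> carrier W. K \<subseteq> left_descents w}"
  let ?B = "(\<lambda>w. s k \<otimes> w) ` ?A (insert k K)"
  have k: "k \<in> {1..N}" using insert.prems by auto
  have "card (?A (insert k K)) * 2 = card (?A (insert k K)) + card ?B"
    using k by (subst card_image) (auto intro!: inj_onI)
  also have "\<dots> = card (?A (insert k K) \<union> ?B)"
    using finite_carrier not_left_descent_mult by (subst card_Un_disjoint) auto
  also have "\<dots> \<le> card (?A K)"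
  proof (rule card_mono)
    show "finite (?A K)" using finite_carrier by simp
    have "j \<in> left_descents (s k \<otimes> w)" if "w \<in> ?A (insert k K)" "j \<in> K" for w j
    proof (rule left_descent_mult_commuting)
      show "s k \<noteq> s j"
        using insert.prems(2) insert.hyps(2) that(2) by (auto simp: inj_on_def)
    qed (use insert.prems that in auto)
    then show "?A (insert k K) \<union> ?B \<subseteq> ?A K" using k by auto
  qed
  finally have "card (?A (insert k K)) * 2 * 2 ^ card K \<le> card (?A K) * 2 ^ card K"
    by (rule mult_right_mono) simp
  also have "\<dots> \<le> card (carrier W)"
    using insert.IH insert.prems by (auto simp: inj_on_def)
  finally show ?case using insert.hyps by (simp add: mult.assoc)
qed

end

section \<open>Transitive actions of a finite Coxeter group\<close>

text \<open>An action is given on generators only, with relators acting trivially on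
  \<open>\<Omega>\<close>. A word acts through \<open>foldr\<close>, last letter first, which yields
  a left action.\<close>

locale coxeter_action = finite_coxeter_system +
  fixes \<Omega> :: "'x set" and f :: "nat \<Rightarrow> 'x \<Rightarrow> 'x"
  assumes finite_points: "finite \<Omega>"
    and action_closed: "i \<in> {1..N} \<Longrightarrow> x \<in> \<Omega> \<Longrightarrow> f i x \<in> \<Omega>"
    and action_relator: "i \<in> {1..N} \<Longrightarrow> j \<in> {1..N} \<Longrightarrow> x \<in> \<Omega> \<Longrightarrow> ((f i \<circ> f j) ^^ m i j) x = x"
    and transitive: "x \<in> \<Omega> \<Longrightarrow> y \<in> \<Omega> \<Longrightarrow> \<exists>u. set u \<subseteq> {1..N} \<and> foldr f u x = y"
begin

lemma foldr_closed: "set u \<subseteq> {1..N} \<Longrightarrow> x \<in> \<Omega> \<Longrightarrow> foldr f u x \<in> \<Omega>"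
  by (induction u) (auto intro: action_closed)

lemma action_involution: "i \<in> {1..N} \<Longrightarrow> x \<in> \<Omega> \<Longrightarrow> f i (f i x) = x"
  using action_relator[of i i x] coxeter_matrix by (auto simp: is_coxeter_matrix_def)

lemma foldr_rev_cancel:
  "set u \<subseteq> {1..N} \<Longrightarrow> x \<in> \<Omega> \<Longrightarrow> foldr f u (foldr f (rev u) x) = x"
proof (induction u arbitrary: x)
  case (Cons i u)
  then show ?case by (simp add: action_closed action_involution)
qed simp

lemma foldr_equiv: "coxeter_equiv N m u v \<Longrightarrow> x \<in> \<Omega> \<Longrightarrow> foldr f u x = foldr f v x"
proof (induction rule: coxeter_equiv.induct)
  case (rel u v i j)
  have "foldr f (concat (replicate k [i, j])) y = ((f i \<circ> f j) ^^ k) y" for k y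
    by (induction k) auto
  then show ?case using rel action_relator foldr_closed by simp
next
  case (trans u v w)
  show ?case using trans.IH(1)[OF trans.prems] trans.IH(2)[OF trans.prems] by (rule HOL.trans)
next
  case (sym u v)
  show ?case using sym.IH[OF sym.prems] by (rule HOL.sym)
qed simp

text \<open>On \<open>\<Omega>\<close> the chosen word is immaterial: words for the same element are
  equivalent by the presentation, and \<open>foldr_equiv\<close> applies.\<close>

definition act :: "'a \<Rightarrow> 'x \<Rightarrow> 'x" where
  "act w = foldr f (SOME u. set u \<subseteq> {1..N} \<and> wp u = w)"

lemma act_wp:
  assumes "set u \<subseteq> {1..N}" "x \<in> \<Omega>"
  shows "act (wp u) x = foldr f u x"
proof -
  let ?v = "SOME v. set v \<subseteq> {1..N} \<and> wp v = wp u"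
  have "set ?v \<subseteq> {1..N} \<and> wp ?v = wp u"
    by (rule someI[of _ u]) (use assms in auto)
  then show ?thesis
    unfolding act_def using assms presentation foldr_equiv by metis
qed

lemma act_mult:
  assumes "v \<in> carrier W" "w \<in> carrier W" "x \<in> \<Omega>"
  shows "act (v \<otimes> w) x = act v (act w x)"
proof -
  obtain a b where "set a \<subseteq> {1..N}" "wp a = v" "set b \<subseteq> {1..N}" "wp b = w"
    using word_exists assms by metis
  then show ?thesis
    using act_wp[of "a @ b" x] assms(3) by (auto simp: act_wp wp_append foldr_closed)
qed

text \<open>An element carrying \<open>y\<close> to \<open>z\<close> injects, by left translation,
  the fibre of \<open>w \<mapsto> act w x\<close> over \<open>y\<close> into the fibre over
  \<open>z\<close>. All these fibres are disjoint, so \<open>card \<Omega>\<close> copies of the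
  first fit into the group.\<close>

lemma card_transporter:
  assumes "x \<in> \<Omega>" "y \<in> \<Omega>"
  shows "card {w \<in> carrier W. act w x = y} * card \<Omega> \<le> card (carrier W)"
proof -
  let ?A = "\<lambda>z. {w \<in> carrier W. act w x = z}"
  have "card (?A y) \<le> card (?A z)" if z: "z \<in> \<Omega>" for z
  proof -
    obtain u where u: "set u \<subseteq> {1..N}" "foldr f u y = z"
      using transitive[OF assms(2) z] by blast
    have "act (wp u \<otimes> w) x = z" if "w \<in> carrier W" "act w x = y" for w
      using act_mult[OF wp_closed[OF u(1)] that(1) assms(1)] act_wp[OF u(1) assms(2)] that(2) u(2)
      by simp
    note image = this
    show ?thesis
    proof (rule card_inj_on_le)
      show "inj_on (\<lambda>w. wp u \<otimes> w) (?A y)"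
        using wp_closed[OF u(1)] by (intro inj_onI) simp
      show "(\<lambda>w. wp u \<otimes> w) ` ?A y \<subseteq> ?A z"
        using image wp_closed[OF u(1)] by auto
      show "finite (?A z)" using finite_carrier by simp
    qed
  qed
  then have "(\<Sum>z\<in>\<Omega>. card (?A y)) \<le> (\<Sum>z\<in>\<Omega>. card (?A z))"
    by (rule sum_mono)
  also have "\<dots> = card (\<Union>z\<in>\<Omega>. ?A z)"
    using finite_points finite_carrier by (subst card_UN_disjoint) auto
  also have "\<dots> \<le> card (carrier W)"
    using finite_carrier by (intro card_mono) auto
  finally show ?thesis by (simp add: mult.commute)
qed

lemma card_points_le: "card \<Omega> \<le> card (carrier W)"
proof (cases "\<Omega> = {}")
  case False
  then obtain x where x: "x \<in> \<Omega>" by blast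
  have "\<one> \<in> {w \<in> carrier W. act w x = x}"
    using act_wp[of "[]" x] x by simp
  then have "card {w \<in> carrier W. act w x = x} > 0"
    using finite_carrier by (subst card_gt_0_iff) auto
  then show ?thesis
    using card_transporter[OF x x] by (cases "card {w \<in> carrier W. act w x = x}") auto
qed simp

end


section \<open>Permutation actions for types A, B and D\<close>

lemma funpow_id_dvd:
  assumes "(h ^^ k) = id" "k dvd l"
  shows "h ^^ l = id"
  using assms by (auto simp: funpow_mult[symmetric])

lemma transpose_braid:
  assumes "a \<noteq> b" "b \<noteq> c" "a \<noteq> c"
  shows "(Transposition.transpose a b \<circ> Transposition.transpose b c) ^^ 3 = id"
proof
  fix x
  consider "x = a" | "x = b" | "x = c" | "x \<noteq> a" "x \<noteq> b" "x \<noteq> c" by blast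
  then show "((Transposition.transpose a b \<circ> Transposition.transpose b c) ^^ 3) x = id x"
    by cases (use assms in \<open>simp_all add: numeral_3_eq_3 Transposition.transpose_def\<close>)
qed

lemma transpose_disjoint:
  assumes "{a, b} \<inter> {c, d} = {}"
  shows "(Transposition.transpose a b \<circ> Transposition.transpose c d) ^^ 2 = id"
proof
  fix x
  consider "x = a" | "x = b" | "x = c" | "x = d" | "x \<noteq> a" "x \<noteq> b" "x \<noteq> c" "x \<noteq> d" by blast
  then show "((Transposition.transpose a b \<circ> Transposition.transpose c d) ^^ 2) x = id x"
    by cases (use assms in \<open>auto simp: numeral_2_eq_2 Transposition.transpose_def\<close>)
qed

abbreviation adj_transpose :: "nat \<Rightarrow> nat \<Rightarrow> nat" where
  "adj_transpose i \<equiv> Transposition.transpose i (Suc i)"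

lemma adj_transpose_relator:
  "(adj_transpose i \<circ> adj_transpose j) ^^ family_matrix TypeA n i j = id"
proof -
  consider "i = j" | "j = Suc i" | "i = Suc j" | "j > Suc i \<or> i > Suc j" by linarith
  then show ?thesis
  proof cases
    case 2
    then show ?thesis using transpose_braid[of i "Suc i" "Suc (Suc i)"] by simp
  next
    case 3
    then show ?thesis
      using transpose_braid[of "Suc (Suc j)" "Suc j" j] by (simp add: Transposition.transpose_commute)
  next
    case 4
    then show ?thesis
      using transpose_disjoint[of i "Suc i" j "Suc j"] by (auto simp: max_def min_def)
  qed simp
qed

text \<open>These are the permutations left after forgetting signs: in type B the sign change
  \<open>n\<close> becomes the identity, and in type D the generator \<open>n\<close> acts like
  \<open>n - 1\<close>.\<close>

fun family_action :: "coxeter_family \<Rightarrow> nat \<Rightarrow> nat \<Rightarrow> nat \<Rightarrow> nat" where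
  "family_action TypeB n i = (if i = n then id else adj_transpose i)"
| "family_action TypeD n i = (if i = n then adj_transpose (n - 1) else adj_transpose i)"
| "family_action _ n i = adj_transpose i"

definition family_degree :: "coxeter_family \<Rightarrow> nat \<Rightarrow> nat" where
  "family_degree X n = (if X = TypeA then Suc n else n)"

text \<open>In type B the labels joining \<open>n\<close> to other vertices are 2 or 4, so an
  involution raised to them vanishes. In type D, folding \<open>n\<close> onto \<open>n - 1\<close>
  turns every label into a type A label dividing it.\<close>

lemma family_action_relator:
  assumes "X \<noteq> TypeI2" "i \<in> {1..n}" "j \<in> {1..n}" "n \<ge> 4"
  shows "(family_action X n i \<circ> family_action X n j) ^^ family_matrix X n i j = id"
proof (cases X)
  case TypeA
  then show ?thesis using adj_transpose_relator[of n i j] by simp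
next
  case TypeB
  have inv: "adj_transpose l ^^ k = id" if "even k" for l k
    by (rule funpow_id_dvd[of 2]) (use that in \<open>auto simp: numeral_2_eq_2\<close>)
  consider "i < n" "j < n" | "i = n" "j = n" | "i < n" "j = n" | "i = n" "j < n"
    using assms by force
  then show ?thesis
  proof cases
    case 1
    then show ?thesis using TypeB adj_transpose_relator[of n i j] by (auto simp: max_def)
  next
    case 3
    then show ?thesis using TypeB by (auto intro!: inv)
  next
    case 4
    then show ?thesis using TypeB by (auto intro!: inv)
  qed (use TypeB in auto)
next
  case TypeD
  define r where "r i = (if i = n then n - 1 else i)" for i
  have "family_matrix TypeA n (r i) (r j) dvd family_matrix X n i j"
    using assms TypeD by (auto simp: r_def max_def min_def)
  moreover have "family_action X n l = adj_transpose (r l)" for l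
    using TypeD by (simp add: r_def)
  ultimately show ?thesis
    using funpow_id_dvd[OF adj_transpose_relator] by metis
qed (use assms in simp)

text \<open>Both points are joined to 1 by a chain of adjacent transpositions.\<close>

lemma adj_transpose_transitive:
  assumes "\<And>i. 1 \<le> i \<Longrightarrow> i < M \<Longrightarrow> i \<in> A \<and> f i = adj_transpose i"
    and "x \<in> {1..M}" "y \<in> {1..M}"
  shows "\<exists>u. set u \<subseteq> A \<and> foldr f u x = y"
proof -
  have "1 \<le> y \<Longrightarrow> y \<le> M \<Longrightarrow> \<exists>u. set u \<subseteq> A \<and> foldr f u 1 = y" for y
  proof (induction y rule: dec_induct)
    case base
    show ?case by (intro exI[of _ "[]"]) simp
  next
    case (step y)
    then obtain u where "set u \<subseteq> A" "foldr f u 1 = y" by auto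
    then show ?case using assms(1)[of y] step by (intro exI[of _ "y # u"]) auto
  qed
  then obtain u where u: "set u \<subseteq> A" "foldr f u 1 = y" using assms by auto
  have "1 \<le> x \<Longrightarrow> x \<le> M \<Longrightarrow> \<exists>u. set u \<subseteq> A \<and> foldr f u x = 1" for x
  proof (induction x rule: dec_induct)
    case base
    show ?case by (intro exI[of _ "[]"]) simp
  next
    case (step x)
    then obtain u where "set u \<subseteq> A" "foldr f u x = 1" by auto
    then show ?case using assms(1)[of x] step by (intro exI[of _ "u @ [x]"]) auto
  qed
  then obtain v where "set v \<subseteq> A" "foldr f v x = 1" using assms(2) by force
  with u show ?thesis by (intro exI[of _ "u @ v"]) auto
qed

section \<open>Bounding the number of spherical elements through an action by transpositions\<close>

text \<open>\<open>E\<close> stands for the letters \<open>2, 4, ..., 2 * k\<close> and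
  \<open>K\<close> for \<open>2 * k\<close>. By \<open>E_stable\<close> only the letter
  \<open>j\<close> can move a point out of \<open>{1..j}\<close>; evenness keeps letters of
  \<open>E\<close> from being neighbours.\<close>

locale transposition_action = coxeter_action W N s m "{1..M}" f
  for W :: "('a, 'b) monoid_scheme" (structure) and N s m
    and M :: nat and f :: "nat \<Rightarrow> nat \<Rightarrow> nat" +
  fixes E :: "nat set" and K :: nat
  assumes E_sub: "E \<subseteq> {1..N}" and E_even: "j \<in> E \<Longrightarrow> even j"
    and E_le: "j \<in> E \<Longrightarrow> j \<le> K" and K_le: "K \<le> M"
    and E_transpose: "j \<in> E \<Longrightarrow> f j = adj_transpose j"
    and E_stable: "j \<in> E \<Longrightarrow> i \<in> {1..N} \<Longrightarrow> i \<noteq> j \<Longrightarrow> x \<in> {1..j} \<Longrightarrow> f i x \<in> {1..j}"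
    and E_commute: "i \<in> E \<Longrightarrow> j \<in> E \<Longrightarrow> i \<noteq> j \<Longrightarrow> m i j = 2"
begin

lemma foldr_stable:
  assumes "j \<in> E" "set u \<subseteq> {1..N}" "j \<notin> set u" "x \<in> {1..j}"
  shows "foldr f u x \<in> {1..j}"
  using assms(2-)
proof (induction u)
  case (Cons i u)
  then have "foldr f u x \<in> {1..j}" by simp
  then show ?case using E_stable[OF assms(1), of i] Cons.prems by simp
qed simp

lemma card_all_E_descents:
  "card {w \<in> carrier W. E \<subseteq> left_descents w} * 2 ^ card E \<le> card (carrier W)"
proof (rule card_all_left_descents)
  show "finite E" using E_sub finite_subset by blast
  show "inj_on s E"
  proof (rule inj_onI, rule ccontr)
    fix i j assume ij: "i \<in> E" "j \<in> E" "s i = s j" "i \<noteq> j"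
    have i: "i \<in> {1..M}" "set [i] \<subseteq> {1..N}" "set [j] \<subseteq> {1..N}"
      using ij E_sub E_le[of i] K_le by auto
    have "wp [i] = wp [j]" using ij by simp
    \<comment> \<open>Equal generators would act alike on the point \<open>i\<close>; but
      \<open>f i\<close> moves it, while \<open>f j\<close> fixes it because two even numbers are
      never consecutive.\<close>
    then have "f i i = f j i"
      using act_wp[OF i(2,1)] act_wp[OF i(3,1)] by simp
    moreover have "i \<noteq> Suc j" using E_even[OF ij(1)] E_even[OF ij(2)] by auto
    ultimately show False
      using ij by (simp add: E_transpose Transposition.transpose_def)
  qed
  show "s i \<otimes> s j = s j \<otimes> s i" if "i \<in> E" "j \<in> E" for i j
  proof (cases "i = j")
    case False
    have "i \<in> {1..N}" "j \<in> {1..N}" using E_sub that by blast+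
    then show ?thesis using commute_of_m_eq_2 E_commute[OF that False] by blast
  qed simp
qed (use E_sub in simp)

text \<open>
  A letter \<open>j\<close> that occurs at most once leaves most of \<open>{1..j}\<close> inside \<open>{1..j}\<close>; as \<open>j\<close> is even,
  it fixes \<open>1\<close>, and one point that stays inside is the one mapped to \<open>1\<close> before \<open>j\<close> is applied.
\<close>

lemma act_meets_self:
  assumes j: "j \<in> E" and u: "set u \<subseteq> {1..N}" "count_list u j \<le> 1"
  shows "\<exists>a\<in>{1..j}. act (wp u) a \<in> {1..j}"
proof -
  have "j \<noteq> 0" "j \<noteq> 1" using E_sub E_even[OF j] j by auto
  then have j2: "j \<ge> 2" by simp
  have jM: "x \<in> {1..M}" if "x \<in> {1..j}" for x
    using that E_le[OF j] K_le by simp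
  have "\<exists>a\<in>{1..j}. foldr f u a \<in> {1..j}"
  proof (cases "j \<in> set u")
    case False
    then show ?thesis
      using foldr_stable[OF j u(1) False, of 1] j2 by (intro bexI[of _ 1]) auto
  next
    case True
    then obtain x y where xy: "u = x @ j # y" using split_list by metis
    then have "count_list x j + count_list y j = 0" using u(2) by simp
    then have x: "j \<notin> set x" "set x \<subseteq> {1..N}" and y: "j \<notin> set y" "set y \<subseteq> {1..N}"
      using u(1) xy by (auto simp: count_list_0_iff)
    define a where "a = foldr f (rev y) 1"
    have a: "a \<in> {1..j}"
      unfolding a_def using y j2 by (intro foldr_stable[OF j]) auto
    have "foldr f y a = 1"
      unfolding a_def using y j2 jM by (intro foldr_rev_cancel) auto
    then have "foldr f u a = foldr f x 1"
      using j2 by (simp add: xy E_transpose[OF j] Transposition.transpose_def)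
    then show ?thesis
      using foldr_stable[OF j x(2,1), of 1] j2 by (intro bexI[OF _ a]) simp
  qed
  then show ?thesis using act_wp[OF u(1)] jM by metis
qed

text \<open>If some \<open>j\<close> in \<open>E\<close> is not a descent, then (S.1) allows it at
  most once, and \<open>act_meets_self\<close> gives a point of \<open>{1..j}\<close> that stays
  inside \<open>{1..K}\<close>.\<close>

lemma spherical_cases:
  assumes "w \<in> carrier W" "spherical w (left_descents w)"
  shows "E \<subseteq> left_descents w \<or> (\<exists>a\<in>{1..K}. \<exists>b\<in>{1..K}. act w a = b)"
proof (subst disj_commute, rule disjCI)
  assume "\<not> E \<subseteq> left_descents w"
  then obtain j where j: "j \<in> E" "j \<notin> left_descents w" by blast
  obtain u where u: "reduced_word w u" "\<And>j. j \<in> {1..N} - left_descents w \<Longrightarrow> count_list u j \<le> 1"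
    using spherical_word[OF assms(2)] by metis
  have "\<exists>a\<in>{1..j}. act (wp u) a \<in> {1..j}"
    using j u E_sub by (intro act_meets_self) (auto simp: reduced_word_def)
  then obtain a where "a \<in> {1..j}" "act w a \<in> {1..j}"
    using u(1) by (auto simp: reduced_word_def)
  then show "\<exists>a\<in>{1..K}. \<exists>b\<in>{1..K}. act w a = b"
    using E_le[OF j(1)] by auto
qed

text \<open>A union bound over the two cases: all of \<open>E\<close> are descents, or one of the
  \<open>K ^ 2\<close> pairs \<open>(a, b)\<close> satisfies \<open>act w a = b\<close>, each for at
  most a fraction \<open>1 / M\<close> of the group.\<close>

lemma card_spherical_le:
  assumes "M > 0"
  shows "real (card {w \<in> carrier W. spherical w (left_descents w)}) \<le>
    real (card (carrier W)) * (1 / 2 ^ card E + real K ^ 2 / real M)"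
proof -
  let ?C = "real (card (carrier W))"
  let ?A = "{w \<in> carrier W. E \<subseteq> left_descents w}"
  let ?T = "\<lambda>(a, b). {w \<in> carrier W. act w a = b}"
  let ?P = "{1..K} \<times> {1..K}"
  have fin: "finite (?T p)" for p using finite_carrier by (auto split: prod.split)
  have "card {w \<in> carrier W. spherical w (left_descents w)} \<le> card (?A \<union> (\<Union>p\<in>?P. ?T p))"
  proof (rule card_mono)
    show "finite (?A \<union> (\<Union>p\<in>?P. ?T p))" using finite_carrier fin by simp
    show "{w \<in> carrier W. spherical w (left_descents w)} \<subseteq> ?A \<union> (\<Union>p\<in>?P. ?T p)"
    proof
      fix w assume "w \<in> {w \<in> carrier W. spherical w (left_descents w)}"
      then show "w \<in> ?A \<union> (\<Union>p\<in>?P. ?T p)"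
        using spherical_cases[of w] by (cases "E \<subseteq> left_descents w") auto
    qed
  qed
  also have "\<dots> \<le> card ?A + card (\<Union>p\<in>?P. ?T p)" by (rule card_Un_le)
  also have "\<dots> \<le> card ?A + (\<Sum>p\<in>?P. card (?T p))"
    by (intro add_left_mono card_UN_le) simp
  finally have "real (card {w \<in> carrier W. spherical w (left_descents w)}) \<le>
      real (card ?A) + (\<Sum>p\<in>?P. real (card (?T p)))"
    by (simp only: of_nat_le_iff flip: of_nat_add of_nat_sum)
  also have "real (card ?A) \<le> ?C / 2 ^ card E"
  proof -
    have "real (card ?A * 2 ^ card E) \<le> ?C"
      using card_all_E_descents by (simp only: of_nat_le_iff)
    then show ?thesis by (simp add: field_simps)
  qed
  also have "(\<Sum>p\<in>?P. real (card (?T p))) \<le> (\<Sum>p\<in>?P. ?C / real M)"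
  proof (rule sum_mono)
    fix p assume "p \<in> ?P"
    then obtain a b where p: "p = (a, b)" "a \<in> {1..M}" "b \<in> {1..M}" using K_le by auto
    have "real (card (?T p) * M) \<le> ?C"
      using card_transporter[OF p(2,3)] p(1) by (simp only: of_nat_le_iff prod.case card_atLeastAtMost) simp
    then show "real (card (?T p)) \<le> ?C / real M"
      using assms by (simp add: field_simps)
  qed
  also have "(\<Sum>p\<in>?P. ?C / real M) = real K ^ 2 * (?C / real M)"
    by (simp add: power2_eq_square)
  finally show ?thesis by (simp add: algebra_simps)
qed

end

section \<open>The three families as instances\<close>

text \<open>The margin \<open>2 * k + 2 \<le> n\<close> keeps the chosen letters off the vertices
  \<open>n - 1\<close> and \<open>n\<close>, where types B and D differ from type A.\<close>

lemma family_transposition_action: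
  assumes "finite_coxeter_system W (family_rank X n) s (family_matrix X n)"
    and "X \<noteq> TypeI2" "n \<ge> 4" "2 * k + 2 \<le> n"
  shows "transposition_action W (family_rank X n) s (family_matrix X n) (family_degree X n)
    (family_action X n) ((\<lambda>i. 2 * i) ` {1..k}) (2 * k)"
proof -
  have N: "family_rank X n = n" using assms(2) by (cases X) auto
  interpret finite_coxeter_system W n s "family_matrix X n" using assms(1) N by simp
  have lower: "family_action X n i = adj_transpose i" if "i < n \<or> X = TypeA" for i
    using that by (cases X) auto
  show ?thesis unfolding N
  proof unfold_locales
    show "family_action X n i x \<in> {1..family_degree X n}"
      if "i \<in> {1..n}" "x \<in> {1..family_degree X n}" for i x
      using that assms by (cases X) (auto simp: family_degree_def Transposition.transpose_def)
    show "((family_action X n i \<circ> family_action X n j) ^^ family_matrix X n i j) x = x"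
      if "i \<in> {1..n}" "j \<in> {1..n}" for i j x
      using family_action_relator[OF assms(2) that assms(3)] by simp
    show "\<exists>u. set u \<subseteq> {1..n} \<and> foldr (family_action X n) u x = y"
      if "x \<in> {1..family_degree X n}" "y \<in> {1..family_degree X n}" for x y
      by (rule adj_transpose_transitive[OF _ that])
        (use lower in \<open>auto simp: family_degree_def split: if_splits\<close>)
    fix j assume "j \<in> (\<lambda>i. 2 * i) ` {1..k}"
    then have j: "even j" "2 \<le> j" "j \<le> 2 * k" by auto
    then show "even j" "j \<le> 2 * k" by auto
    show "family_action X n j = adj_transpose j" using j assms by (intro lower) auto
    show "family_action X n i x \<in> {1..j}" if "i \<in> {1..n}" "i \<noteq> j" "x \<in> {1..j}" for i x
      using that assms j by (cases X) (auto simp: Transposition.transpose_def)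
    show "family_matrix X n i j = 2" if "i \<in> (\<lambda>i. 2 * i) ` {1..k}" "i \<noteq> j" for i
    proof -
      have "even i" "i \<le> 2 * k" using that by auto
      moreover from this have "max i j \<noteq> min i j + 1"
        using j by (auto simp: max_def min_def)
      ultimately show ?thesis
        using that assms j by (cases X) auto
    qed
  qed (use assms in \<open>auto simp: family_degree_def\<close>)
qed

section \<open>Alternating words and Coxeter systems of rank two\<close>

text \<open>The map \<open>i \<mapsto> 3 - i\<close> exchanges the letters 1 and 2.\<close>

fun alt_word :: "nat \<Rightarrow> nat \<Rightarrow> nat list" where
  "alt_word i 0 = []"
| "alt_word i (Suc k) = i # alt_word (3 - i) k"

lemma length_alt_word [simp]: "length (alt_word i k) = k"
  by (induction k arbitrary: i) auto

lemma set_alt_word: "i \<in> {1..2} \<Longrightarrow> set (alt_word i k) \<subseteq> {1..2}"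
proof (induction k arbitrary: i)
  case (Suc k)
  have "3 - i \<in> {1..2}" using Suc.prems by auto
  from Suc.IH[OF this] Suc.prems show ?case by simp
qed simp

lemma distinct_adj_eq_alt_word:
  "distinct_adj u \<Longrightarrow> set u \<subseteq> {1..2} \<Longrightarrow> u \<noteq> [] \<Longrightarrow> u = alt_word (hd u) (length u)"
proof (induction u)
  case (Cons i u)
  show ?case
  proof (cases "u = []")
    case False
    then have "hd u \<in> {1..2}" using Cons.prems by (cases u) auto
    moreover have "hd u \<noteq> i" using Cons.prems False by (cases u) auto
    ultimately have "hd u = 3 - i" using Cons.prems by auto
    moreover have "distinct_adj u" using Cons.prems False by (cases u) auto
    ultimately show ?thesis using Cons False by simp
  qed simp
qed simp

lemma count_alt_word_ge_2:
  assumes "i \<in> {1..2}" "j \<in> {1..2}" "k \<ge> 4"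
  shows "count_list (alt_word i k) j \<ge> 2"
proof -
  obtain l where "k = 4 + l" using assms(3) le_Suc_ex by blast
  then have "k = Suc (Suc (Suc (Suc l)))" by simp
  then show ?thesis using assms by auto
qed

context coxeter_system
begin

lemma cox_length_mult_le:
  assumes "i \<in> {1..N}" "w \<in> carrier W"
  shows "cox_length (s i \<otimes> w) \<le> Suc (cox_length w)"
proof -
  obtain u where "reduced_word w u" using reduced_word_exists assms by blast
  then show ?thesis
    using cox_length_le[of "i # u"] assms by (auto simp: reduced_word_def)
qed

lemma reduced_distinct_adj:
  "set u \<subseteq> {1..N} \<Longrightarrow> cox_length (wp u) = length u \<Longrightarrow> distinct_adj u"
proof (induction u)
  case (Cons i u)
  have i: "i \<in> {1..N}" and u: "set u \<subseteq> {1..N}" using Cons.prems by auto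
  have "length u \<le> cox_length (wp u)"
    using cox_length_mult_le[OF i wp_closed[OF u]] Cons.prems by simp
  then have "cox_length (wp u) = length u" using cox_length_le[OF u] by simp
  then have "distinct_adj u" using Cons.IH u by simp
  moreover have False if "u = i # v" for v
  proof -
    have "wp (i # u) = wp v" using that i u by (simp add: s_cancel)
    then show False using Cons.prems that u cox_length_le[of v] by simp
  qed
  ultimately show ?case by (cases u) auto
qed simp

context
  assumes N2: "N = 2"
begin

lemma reduced_word_eq_alt_word:
  assumes "reduced_word w u" "u \<noteq> []"
  shows "u = alt_word (hd u) (cox_length w)"
proof -
  have u: "set u \<subseteq> {1..N}" "length u = cox_length w" "wp u = w"
    using assms(1) by (auto simp: reduced_word_def)
  then have "distinct_adj u" using reduced_distinct_adj by simp
  from distinct_adj_eq_alt_word[OF this _ assms(2)] u N2 show ?thesis by simp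
qed

text \<open>Once the two alternating words of length \<open>k\<close> agree, no longer alternating
  word is reduced: at length \<open>k + 1\<close> the two words can be swapped behind the first
  letter, which then cancels, and each further letter adds at most 1 to the length.\<close>

lemma alt_word_collision:
  assumes "wp (alt_word 1 k) = wp (alt_word 2 k)" "k \<ge> 1" "L > k" "i \<in> {1..2}"
  shows "cox_length (wp (alt_word i L)) < L"
proof -
  have "Suc k \<le> L" using assms by simp
  then show ?thesis using assms(4)
  proof (induction L arbitrary: i rule: dec_induct)
    case base
    obtain k' where k': "k = Suc k'" using assms(2) by (cases k) auto
    have i: "i \<in> {1..N}" and i': "3 - i \<in> {1..2}" using base N2 by auto
    have set: "set (alt_word (3 - i) k') \<subseteq> {1..N}" using set_alt_word[OF i'] N2 by simp
    have "i = 1 \<or> i = 2" using base by auto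
    then have "wp (alt_word (3 - i) k) = wp (alt_word i k)" using assms(1) by auto
    then have "wp (alt_word i (Suc k)) = wp (alt_word (3 - i) k')"
      using i set by (simp add: k' s_cancel)
    then show ?case using cox_length_le[OF set] k' by simp
  next
    case (step L)
    have i: "i \<in> {1..N}" and i': "3 - i \<in> {1..2}" using step.prems N2 by auto
    have "set (alt_word (3 - i) L) \<subseteq> {1..N}" using set_alt_word[OF i'] N2 by simp
    from cox_length_mult_le[OF i wp_closed[OF this]] step.IH[OF i'] show ?case by simp
  qed
qed

text \<open>Putting \<open>j\<close> in front of a reduced word of \<open>s j \<otimes> w\<close>
  gives a reduced word of \<open>w\<close>, and reduced words on two letters alternate.\<close>

lemma left_descent_eq_alt_word:
  assumes w: "w \<in> carrier W" and j: "j \<in> left_descents w"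
  shows "w = wp (alt_word j (cox_length w))"
proof -
  have jN: "j \<in> {1..N}" and less: "cox_length (s j \<otimes> w) < cox_length w"
    using j by (auto simp: left_descents_def)
  obtain v where v: "reduced_word (s j \<otimes> w) v"
    using reduced_word_exists jN w by (metis m_closed s_closed)
  have set: "set (j # v) \<subseteq> {1..N}" and jv: "wp (j # v) = w"
    using v jN w by (auto simp: reduced_word_def s_cancel)
  have "length (j # v) = cox_length w"
    using cox_length_le[OF set] v less unfolding jv by (simp add: reduced_word_def)
  then have "reduced_word w (j # v)" using set jv by (simp add: reduced_word_def)
  from reduced_word_eq_alt_word[OF this] jv show ?thesis by simp
qed

text \<open>With both descents, \<open>w\<close> equals both alternating words of its length. This
  collision rules out a longer reduced alternating word, such as the one for
  \<open>v\<close>.\<close>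

lemma full_descents_length_le:
  assumes "w \<in> carrier W" "left_descents w = {1..2}" "v \<in> carrier W" "left_descents v = {1..2}"
  shows "cox_length v \<le> cox_length w"
proof (rule ccontr)
  assume *: "\<not> cox_length v \<le> cox_length w"
  have "1 \<in> left_descents w" "2 \<in> left_descents w" "1 \<in> left_descents v" using assms by auto
  then have eq: "w = wp (alt_word 1 (cox_length w))" "w = wp (alt_word 2 (cox_length w))"
    "v = wp (alt_word 1 (cox_length v))" and "cox_length w \<ge> 1"
    using left_descent_eq_alt_word assms by (auto simp: left_descents_def)
  then have "cox_length (wp (alt_word 1 (cox_length v))) < cox_length v"
    using * by (intro alt_word_collision[of "cox_length w"]) auto
  then show False using eq(3) by simp
qed

lemma full_descents_unique:
  assumes "w \<in> carrier W" "left_descents w = {1..2}" "v \<in> carrier W" "left_descents v = {1..2}"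
  shows "v = w"
proof -
  have "cox_length v = cox_length w"
    using full_descents_length_le[OF assms] full_descents_length_le[OF assms(3,4,1,2)] by simp
  then show ?thesis
    using left_descent_eq_alt_word[OF assms(1), of 1] left_descent_eq_alt_word[OF assms(3), of 1]
      assms by simp
qed

text \<open>A letter that is not a descent occurs at most once by (S.1), whereas an alternating word
  of length at least 4 contains both letters twice.\<close>

lemma spherical_rank_2_cases:
  assumes "spherical w (left_descents w)"
  shows "left_descents w = {1..2} \<or> w \<in> (\<lambda>(i, k). wp (alt_word i k)) ` ({1..2} \<times> {0..3})"
proof (subst disj_commute, rule disjCI)
  have sub: "left_descents w \<subseteq> {1..N}" by (auto simp: left_descents_def)
  have N: "{1..N} = {1..2}" using N2 by simp
  assume "left_descents w \<noteq> {1..2}"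
  then obtain j where j: "j \<in> {1..2}" "j \<notin> left_descents w"
    using sub unfolding N by blast
  obtain u where u: "reduced_word w u" "\<And>j. j \<in> {1..N} - left_descents w \<Longrightarrow> count_list u j \<le> 1"
    using spherical_word[OF assms] by metis
  have w: "w = wp u" using u by (simp add: reduced_word_def)
  show "w \<in> (\<lambda>(i, k). wp (alt_word i k)) ` ({1..2} \<times> {0..3})"
  proof (cases "u = []")
    case True
    then show ?thesis using w by (intro image_eqI[of _ _ "(1, 0)"]) auto
  next
    case False
    then have eq: "u = alt_word (hd u) (cox_length w)"
      using reduced_word_eq_alt_word[OF u(1)] by simp
    have hd: "hd u \<in> {1..2}" using u(1) False N hd_in_set unfolding reduced_word_def by blast
    have "count_list (alt_word (hd u) (cox_length w)) j \<le> 1"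
      using u(2)[of j] j N2 eq by simp
    then have "cox_length w \<le> 3"
      using count_alt_word_ge_2[OF hd j(1), of "cox_length w"] by linarith
    then show ?thesis
      using w eq hd by (intro image_eqI[of _ _ "(hd u, cox_length w)"]) auto
  qed
qed

lemma card_spherical_rank_2:
  "card {w \<in> carrier W. spherical w (left_descents w)} \<le> 9"
proof -
  let ?D = "{w \<in> carrier W. left_descents w = {1..2}}"
  let ?I = "(\<lambda>(i, k). wp (alt_word i k)) ` ({1..2} \<times> {0..3})"
  \<comment> \<open>Finiteness is proved along with the bound: the carrier may be infinite in this
    context, and \<open>card_mono\<close> asks for a finite superset.\<close>
  have D: "finite ?D \<and> card ?D \<le> 1"
  proof (cases "?D = {}")
    case False
    then obtain w where "w \<in> ?D" by blast
    then have "?D \<subseteq> {w}" using full_descents_unique by blast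
    then show ?thesis using finite_subset card_mono[of "{w}" ?D] by auto
  next
    case True
    show ?thesis unfolding True by simp
  qed
  \<comment> \<open>Two first letters and the four lengths from 0 to 3 give at most 8
    elements.\<close>
  have "card ?I \<le> card ({1..2::nat} \<times> {0..3::nat})" by (intro card_image_le) auto
  then have I: "card ?I \<le> 8" by simp
  have "card {w \<in> carrier W. spherical w (left_descents w)} \<le> card (?D \<union> ?I)"
    using D spherical_rank_2_cases by (intro card_mono) auto
  also have "\<dots> \<le> card ?D + card ?I" by (rule card_Un_le)
  finally show ?thesis using D I by linarith
qed

end

end

section \<open>The dihedral action on residues modulo n\<close>

text \<open>Generator \<open>i\<close> acts as the reflection \<open>x \<mapsto> i - x\<close>, so a
  product of two generators is translation by the difference of their indices. Translation by 1
  gives transitivity, and through \<open>card_points_le\<close> the group has at least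
  \<open>n\<close> elements.\<close>

lemma dihedral_action:
  assumes "finite_coxeter_system W 2 s (family_matrix TypeI2 n)" "n \<ge> 3"
  shows "coxeter_action W 2 s (family_matrix TypeI2 n) {0..<int n} (\<lambda>i x. (int i - x) mod int n)"
proof -
  interpret finite_coxeter_system W 2 s "family_matrix TypeI2 n" by fact
  let ?f = "\<lambda>i x. (int i - x) mod int n"
  have two: "?f i (?f j x) = (x + (int i - int j)) mod int n" for i j x
    by (simp add: mod_diff_right_eq algebra_simps)
  have step: "(?f i \<circ> ?f j) x = (x + (int i - int j)) mod int n" for i j x
    by (simp only: o_apply two)
  have pow: "((?f i \<circ> ?f j) ^^ k) x = (x + int k * (int i - int j)) mod int n"
    if "x \<in> {0..<int n}" for i j k x
  proof (induction k)
    case (Suc k)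
    let ?d = "int i - int j"
    have "((?f i \<circ> ?f j) ^^ Suc k) x = ((x + int k * ?d) mod int n + ?d) mod int n"
      by (simp only: funpow.simps o_apply[of "?f i \<circ> ?f j"] Suc.IH step)
    also have "\<dots> = (x + int k * ?d + ?d) mod int n"
      by (rule mod_add_left_eq)
    also have "\<dots> = (x + int (Suc k) * ?d) mod int n" by (simp add: algebra_simps)
    finally show ?case .
  qed (use that in simp)
  show ?thesis
  proof unfold_locales
    show "?f i x \<in> {0..<int n}" for i x using assms(2) by simp
    show "((?f i \<circ> ?f j) ^^ family_matrix TypeI2 n i j) x = x" if "x \<in> {0..<int n}" for i j x
      using pow[OF that] that by simp
    show "\<exists>u. set u \<subseteq> {1..2} \<and> foldr ?f u x = y"
      if "x \<in> {0..<int n}" "y \<in> {0..<int n}" for x y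
    proof -
      define k where "k = nat ((y - x) mod int n)"
      have "foldr ?f (concat (replicate l [2, 1])) z = ((?f 2 \<circ> ?f 1) ^^ l) z" for l z
        by (induction l) auto
      then have "foldr ?f (concat (replicate k [2, 1])) x = (x + int k) mod int n"
        using pow[OF that(1), of k 2 1] by simp
      also have "\<dots> = y" using that assms(2) by (simp add: k_def mod_add_right_eq)
      finally show ?thesis
        by (intro exI[of _ "concat (replicate k [2, 1])"]) auto
    qed
  qed simp
qed

section \<open>The limit of the probabilities\<close>

theorem theorem1p11:
  fixes X :: coxeter_family
    and W :: "nat \<Rightarrow> ('a, 'b) monoid_scheme"
    and s :: "nat \<Rightarrow> nat \<Rightarrow> 'a"
  assumes "\<And>n. n \<ge> family_start X \<Longrightarrow>
    finite_coxeter_system (W n) (family_rank X n) (s n) (family_matrix X n)"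
  shows "(\<lambda>n. measure_pmf.prob (pmf_of_set (carrier (W n)))
      {w. coxeter_system.spherical (W n) (family_rank X n) (s n) (family_matrix X n) w
            (coxeter_system.left_descents (W n) (family_rank X n) (s n) w)})
    \<longlonglongrightarrow> 0"
proof -
  let ?S = "\<lambda>n. {w \<in> carrier (W n).
    coxeter_system.spherical (W n) (family_rank X n) (s n) (family_matrix X n) w
      (coxeter_system.left_descents (W n) (family_rank X n) (s n) w)}"
  define p where "p n = real (card (?S n)) / real (card (carrier (W n)))" for n
  \<comment> \<open>The number 4 is the largest value of \<open>family_start\<close>, so one
    threshold serves all families.\<close>
  have pos: "0 < card (carrier (W n))" if "n \<ge> 4" for n
  proof -
    interpret finite_coxeter_system "W n" "family_rank X n" "s n" "family_matrix X n"
      using that by (intro assms) (cases X; simp)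
    show ?thesis using finite_carrier by (auto simp: card_gt_0_iff)
  qed
  have prob: "measure_pmf.prob (pmf_of_set (carrier (W n)))
      {w. coxeter_system.spherical (W n) (family_rank X n) (s n) (family_matrix X n) w
            (coxeter_system.left_descents (W n) (family_rank X n) (s n) w)} = p n"
    if "n \<ge> 4" for n
    using pos[OF that] by (subst measure_pmf_of_set) (auto simp: p_def card_gt_0_iff Collect_conj_eq)
  have "p \<longlonglongrightarrow> 0"
  proof (cases "X = TypeI2")
    case True
    have "norm (p n) \<le> 9 / real n" if n: "n \<ge> 4" for n
    proof -
      have fcs: "finite_coxeter_system (W n) 2 (s n) (family_matrix TypeI2 n)"
        using assms[of n] True n by simp
      interpret coxeter_action "W n" 2 "s n" "family_matrix TypeI2 n" "{0..<int n}"
        "\<lambda>i x. (int i - x) mod int n"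
        using dihedral_action[OF fcs] n by simp
      have "card (?S n) \<le> 9" using card_spherical_rank_2 True by simp
      moreover have "n \<le> card (carrier (W n))" using card_points_le by simp
      ultimately show ?thesis using n by (simp add: p_def frac_le)
    qed
    then have "eventually (\<lambda>n. norm (p n) \<le> 9 / real n) sequentially"
      using eventually_sequentially by blast
    then show ?thesis by (rule Lim_null_comparison) real_asymp
  next
    case False
    have bound: "p n \<le> 1 / 2 ^ k + (2 * real k) ^ 2 / real n" if n: "n \<ge> 4" "2 * k + 2 \<le> n" for n k
    proof -
      have fcs: "finite_coxeter_system (W n) (family_rank X n) (s n) (family_matrix X n)"
        using n by (intro assms) (cases X; simp)
      interpret transposition_action "W n" "family_rank X n" "s n" "family_matrix X n"
        "family_degree X n" "family_action X n" "(\<lambda>i. 2 * i) ` {1..k}" "2 * k"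
        by (rule family_transposition_action[OF fcs False n])
      have deg: "n \<le> family_degree X n" by (simp add: family_degree_def)
      have "card ((\<lambda>i::nat. 2 * i) ` {1..k}) = k" by (subst card_image) (auto intro: inj_onI)
      then have "p n \<le> 1 / 2 ^ k + (2 * real k) ^ 2 / real (family_degree X n)"
        using card_spherical_le deg n pos[of n] by (simp add: p_def divide_le_eq mult.commute)
      \<comment> \<open>The degree is \<open>n + 1\<close> in type A and \<open>n\<close> otherwise;
        passing to \<open>n\<close> makes the bound uniform.\<close>
      also have "(2 * real k) ^ 2 / real (family_degree X n) \<le> (2 * real k) ^ 2 / real n"
        using deg n by (intro divide_left_mono) auto
      finally show ?thesis by simp
    qed
    show ?thesis
    proof (rule LIMSEQ_I)
      fix e :: real assume e: "e > 0"
      \<comment> \<open>First \<open>k\<close> is fixed to make the descent term small; only then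
        does \<open>n\<close> grow to make the fixed-numerator term small.\<close>
      obtain k where k: "(1 / 2) ^ k < e / 2"
        using real_arch_pow_inv[of "e / 2" "1 / 2"] e by auto
      have "(\<lambda>n. (2 * real k) ^ 2 / real n) \<longlonglongrightarrow> 0" by real_asymp
      then obtain n0 where n0: "\<And>n. n \<ge> n0 \<Longrightarrow> (2 * real k) ^ 2 / real n < e / 2"
        using e by (force dest!: order_tendstoD(2)[of _ _ _ "e / 2"] simp: eventually_sequentially)
      \<comment> \<open>The threshold \<open>2 * k + 4\<close> ensures both \<open>n \<ge> 4\<close>
        and \<open>2 * k + 2 \<le> n\<close>.\<close>
      have "norm (p n - 0) < e" if "n \<ge> max n0 (2 * k + 4)" for n
      proof -
        have "p n \<le> 1 / 2 ^ k + (2 * real k) ^ 2 / real n" using bound[of n k] that by simp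
        moreover have "p n \<ge> 0" by (simp add: p_def)
        ultimately show ?thesis using k n0[of n] that by (simp add: power_one_over)
      qed
      then show "\<exists>n1. \<forall>n\<ge>n1. norm (p n - 0) < e" by blast
    qed
  qed
  then show ?thesis
    by (rule Lim_transform_eventually, intro eventually_sequentiallyI[of 4]) (simp only: prob)
qed

end
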